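(* Let $G$ be a graph on the vertex set $V=\{1,\dots,n\}$ with graph state $|G\rangle$. Let $A=\mathrm{nbhd}(1)\cup\{1\}$, let $B\subseteq V$ be a set with $1\in B$, and let $k$ be an integer. Then $$\frac{1}{\sqrt2}\Bigl(I+i^k\prod_{j\in B}Z_j\Bigr)|G\rangle \;=\; H_1\,Z_1\prod_{x\in A,\;y\in A}CS_{x,y}^{\,k}\prod_{x\in A,\;y\in B}CZ_{x,y}\;|G\rangle ,$$ where the products run over all ordered pairs $(x,y)\in A\times A$ and $(x,y)\in A\times B$ respectively, and where by convention $CS_{x,x}=S_x$ and $CZ_{x,x}=Z_x$.
   Context: All states live in $(\mathbb{C}^2)^{\otimes n}$, with qubits numbered $1,\dots,n$. For a one- or two-qubit gate $W$, $W_a$ (respectively $W_{a,b}$) denotes $W$ applied to qubit $a$ (respectively to qubits $a,b$) and the identity on all other qubits. Gates: $X=\begin{pmatrix}0&1\\1&0\end{pmatrix}$, $Z=\begin{pmatrix}1&0\\0&-1\end{pmatrix}$, $H=\frac{1}{\sqrt2}\begin{pmatrix}1&1\\1&-1\end{pmatrix}$, $S=\begin{pmatrix}1&0\\0&i\end{pmatrix}$. For $a\neq b$, $CZ_{a,b}$ and $CS_{a,b}$ are the controlled-$Z$ and controlled-$S$ gates with control $a$ and target $b$, i.e. the diagonal gates $\mathrm{diag}(1,1,1,-1)$ and $\mathrm{diag}(1,1,1,i)$ on qubits $a,b$. Convention: for a controlled gate $CW_{a,b}$ with $b=a$, one sets $CW_{a,a}=W_a$. All the $Z$, $S$, $CZ$,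 $CS$ operators are diagonal, so they commute and the products are well defined; the operators on the right-hand side are applied to $|G\rangle$ from right to left. Graphs are finite, simple and undirected. $\mathrm{nbhd}(a)$ is the set of vertices adjacent to $a$. For a graph $G=(V,E)$ with $V=\{1,\dots,n\}$, the graph state $|G\rangle$ is the unit vector stabilized by $g_i=X_i\prod_{j\in\mathrm{nbhd}(i)}Z_j$ for all $i\in V$, with phase fixed by $|G\rangle=\prod_{\{a,b\}\in E}CZ_{a,b}\,|+\rangle^{\otimes n}$, where $|+\rangle=\frac{1}{\sqrt2}(|0\rangle+|1\rangle)$. *)

theory Defs
  imports
    "HOL-Algebra.FiniteProduct"
    "Jordan_Normal_Form.Matrix"
    Complex_Main
begin

(* The space of n qubits is complex^(2^n).  Basis states are indexed by 0, ..., 2^n - 1; qubits are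
   numbered 1, ..., n, and qubit 1 is the most significant bit, so that the ordering of the basis is
   that of the Kronecker product. *)
definition qubit :: "nat \<Rightarrow> nat \<Rightarrow> nat \<Rightarrow> nat" where
  "qubit n a r = (r div 2 ^ (n - a)) mod 2"

definition tensor_power :: "nat \<Rightarrow> complex vec \<Rightarrow> complex vec" where
  "tensor_power n v = vec (2 ^ n) (\<lambda>r. \<Prod>a\<in>{1..n}. v $ qubit n a r)"

definition on_qubit :: "nat \<Rightarrow> complex mat \<Rightarrow> nat \<Rightarrow> complex mat" where
  "on_qubit n W a = mat (2 ^ n) (2 ^ n) (\<lambda>(r, c).
     if \<forall>d\<in>{1..n} - {a}. qubit n d r = qubit n d c
     then W $$ (qubit n a r, qubit n a c) else 0)"

(* Meaningful for distinct a and b; a is the more significant of the two qubits of W. *)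
definition on_qubits :: "nat \<Rightarrow> complex mat \<Rightarrow> nat \<Rightarrow> nat \<Rightarrow> complex mat" where
  "on_qubits n W a b = mat (2 ^ n) (2 ^ n) (\<lambda>(r, c).
     if \<forall>d\<in>{1..n} - {a, b}. qubit n d r = qubit n d c
     then W $$ (2 * qubit n a r + qubit n b r, 2 * qubit n a c + qubit n b c) else 0)"

definition gate_Z :: "complex mat" where
  "gate_Z = mat_of_rows_list 2 [[1, 0], [0, -1]]"

definition gate_H :: "complex mat" where
  "gate_H = complex_of_real (1 / sqrt 2) \<cdot>\<^sub>m mat_of_rows_list 2 [[1, 1], [1, -1]]"

definition gate_S :: "complex mat" where
  "gate_S = mat_of_rows_list 2 [[1, 0], [0, \<i>]]"

definition ket_plus :: "complex vec" where
  "ket_plus = complex_of_real (1 / sqrt 2) \<cdot>\<^sub>v vec_of_list [1, 1]"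

definition controlled_gate :: "complex mat \<Rightarrow> complex mat" where
  "controlled_gate W = four_block_mat (1\<^sub>m 2) (0\<^sub>m 2 2) (0\<^sub>m 2 2) W"

definition controlled :: "nat \<Rightarrow> complex mat \<Rightarrow> nat \<Rightarrow> nat \<Rightarrow> complex mat" where
  "controlled n W a b =
     (if a = b then on_qubit n W a else on_qubits n (controlled_gate W) a b)"

abbreviation Z_op :: "nat \<Rightarrow> nat \<Rightarrow> complex mat" where
  "Z_op n a \<equiv> on_qubit n gate_Z a"

abbreviation H_op :: "nat \<Rightarrow> nat \<Rightarrow> complex mat" where
  "H_op n a \<equiv> on_qubit n gate_H a"

abbreviation CZ :: "nat \<Rightarrow> nat \<Rightarrow> nat \<Rightarrow> complex mat" where
  "CZ n \<equiv> controlled n gate_Z"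

abbreviation CS :: "nat \<Rightarrow> nat \<Rightarrow> nat \<Rightarrow> complex mat" where
  "CS n \<equiv> controlled n gate_S"

(* Products over finite sets and integer powers of operators are finprod and [^] in this ring. *)
abbreviation op_ring :: "nat \<Rightarrow> complex mat ring" where
  "op_ring n \<equiv> ring_mat TYPE(complex) (2 ^ n) ()"

(* The ring of operators is not commutative, but finprod is the usual product, independent of the
   order of the factors, whenever the factors commute pairwise. *)
lemma (in monoid) finprod_empty_monoid: "finprod G f {} = \<one>"
  by (simp add: finprod_def)

lemma (in monoid) finprod_insert_commuting:
  assumes "finite F" "a \<notin> F" "f \<in> insert a F \<rightarrow> carrier G"
    and comm: "\<And>x y. x \<in> insert a F \<Longrightarrow> y \<in> insert a F \<Longrightarrow> f x \<otimes> f y = f y \<otimes> f x"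
  shows "finprod G f (insert a F) = f a \<otimes> finprod G f F"
proof -
  interpret LCD "insert a F" "carrier G" "(\<otimes>) \<circ> f"
  proof
    fix x y z assume *: "x \<in> insert a F" "y \<in> insert a F" "z \<in> carrier G"
    then have "f x \<in> carrier G" "f y \<in> carrier G" using assms(3) by auto
    then show "((\<otimes>) \<circ> f) x (((\<otimes>) \<circ> f) y z) = ((\<otimes>) \<circ> f) y (((\<otimes>) \<circ> f) x z)"
      using comm[OF *(1,2)] *(3) by (metis comp_apply m_assoc)
  qed (use assms(3) in auto)
  show ?thesis
    using assms(1,2) by (simp add: finprod_def foldD_insert[OF _ _ _ _ subset_insertI])
qed

definition simple_graph_on :: "nat set \<Rightarrow> nat set set \<Rightarrow> bool" where
  "simple_graph_on V E \<longleftrightarrow> finite V \<and> (\<forall>e\<in>E. e \<subseteq> V \<and> card e = 2)"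

definition nbhd :: "nat set set \<Rightarrow> nat \<Rightarrow> nat set" where
  "nbhd E a = {b. {a, b} \<in> E}"

(* Among the unit vectors stabilized by all X_i * (product of Z_j over the neighbours j of i), which
   differ only by a phase, the graph state is the one given by this product.  CZ is symmetric in its
   two qubits, so it does not matter which endpoint of an edge is the control. *)
definition graph_state :: "nat \<Rightarrow> nat set set \<Rightarrow> complex vec" where
  "graph_state n E =
     (\<Otimes>\<^bsub>op_ring n\<^esub>e\<in>E. CZ n (Min e) (Max e)) *\<^sub>v tensor_power n ket_plus"

end

theory Submission
  imports Defs
begin

text \<open>
  All operators except the Hadamard gate are diagonal in the computational basis. On a basis state
  with bits \<open>q j\<close>, let \<open>S\<close> and \<open>T\<close> be the sums of the bits over \<open>A\<close> and
  over \<open>B\<close>; the CS-product contributes \<open>(\<i> powi k) ^ S\<^sup>2\<close>, which is 1 or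
  \<open>\<i> powi k\<close> according to the parity of \<open>S\<close>, and the CZ-product contributes
  \<open>(-1) ^ (S * T)\<close>. The graph state depends on qubit 1 only through the sign
  \<open>(-1) ^ (q 1 * (S - q 1))\<close>. For fixed bits of the other qubits, the two values of qubit 1 give
  the two parities of \<open>S\<close>, so the Hadamard gate adds one term for each parity; these are the
  two terms of the left-hand side.
\<close>

section \<open>Basis indices and their bits\<close>

lemma dim_mat_diag [simp]: "dim_row (mat_diag N f) = N" "dim_col (mat_diag N f) = N"
  by (simp_all add: mat_diag_def)

lemma qubit_eq_bit: "qubit n a r = of_bool (bit r (n - a))"
  by (simp add: qubit_def bit_iff_odd mod_2_eq_odd)

lemma qubit_cases: "qubit n a r = 0 \<or> qubit n a r = 1"
  by (simp add: qubit_eq_bit)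

text \<open>Qubits 1 to \<open>n\<close> are exactly the bits \<open>n - 1\<close> down to 0, and
  all higher bits of an index below \<open>2 ^ n\<close> vanish.\<close>

lemma index_eq_if_qubits_eq:
  assumes "r < 2 ^ n" "c < 2 ^ n" and eq: "\<And>d. d \<in> {1..n} \<Longrightarrow> qubit n d r = qubit n d c"
  shows "r = c"
proof (rule bit_eqI)
  fix m
  show "bit r m \<longleftrightarrow> bit c m"
  proof (cases "m < n")
    case True
    then show ?thesis using eq[of "n - m"] by (auto simp: qubit_eq_bit of_bool_eq_iff)
  next
    case False
    have "take_bit n r = r" "take_bit n c = c"
      using assms by (simp_all add: take_bit_nat_eq_self_iff)
    then show ?thesis using False by (metis bit_take_bit_iff)
  qed
qed

section \<open>Diagonal one- and two-qubit gates\<close>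

lemma on_qubit_diagonal:
  assumes "a \<in> {1..n}"
  shows "on_qubit n (mat_of_rows_list 2 [[1, 0], [0, w]]) a = mat_diag (2 ^ n) (\<lambda>r. w ^ qubit n a r)"
proof (rule eq_matI)
  let ?W = "mat_of_rows_list 2 [[1, 0], [0, w]]"
  fix r c assume "r < dim_row (mat_diag (2 ^ n) (\<lambda>r. w ^ qubit n a r))"
    and "c < dim_col (mat_diag (2 ^ n) (\<lambda>r. w ^ qubit n a r))"
  then have rc: "r < 2 ^ n" "c < 2 ^ n" by simp_all
  show "on_qubit n ?W a $$ (r, c) = mat_diag (2 ^ n) (\<lambda>r. w ^ qubit n a r) $$ (r, c)"
  proof (cases "r = c")
    case True
    then show ?thesis
      using rc by (auto simp: on_qubit_def mat_diag_def mat_of_rows_list_def qubit_eq_bit)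
  next
    case False
    \<comment> \<open>Distinct indices that agree at every qubit other than \<open>a\<close> must
      differ at \<open>a\<close>, where the entry of \<open>?W\<close> is off its diagonal and hence
      0.\<close>
    then have ne: "qubit n a r \<noteq> qubit n a c" if "\<forall>d\<in>{1..n} - {a}. qubit n d r = qubit n d c"
      using index_eq_if_qubits_eq[OF rc] that by blast
    have "?W $$ (qubit n a r, qubit n a c) = 0" if "qubit n a r \<noteq> qubit n a c"
      using that qubit_cases[of n a r] qubit_cases[of n a c] by (auto simp: mat_of_rows_list_def)
    with ne have "on_qubit n ?W a $$ (r, c) = 0" using rc by (simp add: on_qubit_def)
    then show ?thesis using rc False by (simp add: mat_diag_def)
  qed
qed (simp_all add: on_qubit_def)

text \<open>Taking the product of the two bits as exponent covers the convention for
  \<open>a = b\<close> as well, because a bit equals its own square.\<close>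

lemma controlled_diagonal:
  assumes "a \<in> {1..n}" "b \<in> {1..n}"
  shows "controlled n (mat_of_rows_list 2 [[1, 0], [0, w]]) a b
    = mat_diag (2 ^ n) (\<lambda>r. w ^ (qubit n a r * qubit n b r))"
proof (cases "a = b")
  case True
  have "qubit n a r * qubit n a r = qubit n a r" for r
    using qubit_cases[of n a r] by auto
  then have "mat_diag (2 ^ n) (\<lambda>r. w ^ (qubit n a r * qubit n a r))
      = mat_diag (2 ^ n) (\<lambda>r. w ^ qubit n a r)"
    by presburger
  then show ?thesis using on_qubit_diagonal[OF assms(1)] True by (simp add: controlled_def)
next
  case ab: False
  let ?W = "mat_of_rows_list 2 [[1, 0], [0, w]]"
  let ?D = "mat_diag (2 ^ n) (\<lambda>r. w ^ (qubit n a r * qubit n b r))"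
  have "on_qubits n (controlled_gate ?W) a b = ?D"
  proof (rule eq_matI)
    fix r c assume "r < dim_row ?D" and "c < dim_col ?D"
    then have rc: "r < 2 ^ n" "c < 2 ^ n" by simp_all
    show "on_qubits n (controlled_gate ?W) a b $$ (r, c) = ?D $$ (r, c)"
    proof (cases "r = c")
      case True
      then show ?thesis
        using rc by (auto simp: on_qubits_def mat_diag_def mat_of_rows_list_def qubit_eq_bit
            controlled_gate_def)
    next
      case False
      then have ne: "qubit n a r \<noteq> qubit n a c \<or> qubit n b r \<noteq> qubit n b c"
        if "\<forall>d\<in>{1..n} - {a, b}. qubit n d r = qubit n d c"
        using index_eq_if_qubits_eq[OF rc] that by blast
      have "controlled_gate ?W $$ (2 * qubit n a r + qubit n b r, 2 * qubit n a c + qubit n b c) = 0"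
        if "qubit n a r \<noteq> qubit n a c \<or> qubit n b r \<noteq> qubit n b c"
        using that qubit_cases[of n a r] qubit_cases[of n a c] qubit_cases[of n b r]
          qubit_cases[of n b c]
        by (auto simp: controlled_gate_def mat_of_rows_list_def)
      with ne have "on_qubits n (controlled_gate ?W) a b $$ (r, c) = 0"
        using rc by (simp add: on_qubits_def)
      then show ?thesis using rc False by (simp add: mat_diag_def)
    qed
  qed (simp_all add: on_qubits_def)
  then show ?thesis using ab by (simp add: controlled_def)
qed

section \<open>Powers and products of diagonal operators\<close>

lemma monoid_op_ring: "monoid (op_ring n)"
  using ring_mat[where 'a=complex] by (rule ring.is_monoid)

lemma nat_pow_mat_diag:
  "mat_diag (2 ^ n) f [^]\<^bsub>op_ring n\<^esub> (m::nat) = mat_diag (2 ^ n) (\<lambda>r. f r ^ m)"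
proof -
  interpret monoid "op_ring n" by (rule monoid_op_ring)
  show ?thesis
    by (induction m) (simp_all add: nat_pow_Suc ring_mat_simps mat_diag_diag mult.commute)
qed

lemma inv_mat_diag:
  assumes "\<And>r. f r \<noteq> 0"
  shows "inv\<^bsub>op_ring n\<^esub> mat_diag (2 ^ n) f = mat_diag (2 ^ n) (\<lambda>r. inverse (f r))"
proof -
  interpret monoid "op_ring n" by (rule monoid_op_ring)
  show ?thesis
    using assms by (intro inv_char) (simp_all add: ring_mat_simps mat_diag_diag)
qed

lemma int_pow_mat_diag:
  assumes "\<And>r. f r \<noteq> 0"
  shows "mat_diag (2 ^ n) f [^]\<^bsub>op_ring n\<^esub> (k::int) = mat_diag (2 ^ n) (\<lambda>r. f r powi k)"
  using assms by (simp add: int_pow_def2 nat_pow_mat_diag inv_mat_diag power_int_def power_inverse)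

text \<open>Diagonal matrices commute with each other, so factors can be split off one at a time
  although the operator ring is not commutative.\<close>

lemma finprod_mat_diag:
  assumes "finite F" "\<And>x. x \<in> F \<Longrightarrow> g x = mat_diag (2 ^ n) (f x)"
  shows "finprod (op_ring n) g F = mat_diag (2 ^ n) (\<lambda>r. \<Prod>x\<in>F. f x r)"
proof -
  interpret monoid "op_ring n" by (rule monoid_op_ring)
  show ?thesis using assms
  proof (induction F rule: finite_induct)
    case empty
    then show ?case by (simp add: finprod_empty_monoid ring_mat_simps)
  next
    case (insert a F)
    have "finprod (op_ring n) g (insert a F) = g a \<otimes>\<^bsub>op_ring n\<^esub> finprod (op_ring n) g F"
      by (rule finprod_insert_commuting)
        (use insert in \<open>auto simp: ring_mat_simps mat_diag_diag mult.commute\<close>)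
    then show ?case
      using insert by (simp add: ring_mat_simps mat_diag_diag)
  qed
qed

lemma mat_diag_mult_vec:
  assumes "v \<in> carrier_vec N"
  shows "mat_diag N f *\<^sub>v v = vec N (\<lambda>r. f r * v $ r)"
proof (rule eq_vecI)
  fix i assume "i < dim_vec (vec N (\<lambda>r. f r * v $ r))"
  then have i: "i < N" by simp
  then have "(mat_diag N f *\<^sub>v v) $ i = (\<Sum>j\<in>{0..<N}. (if i = j then f j else 0) * v $ j)"
    using assms by (simp add: mat_diag_def scalar_prod_def)
  also have "\<dots> = (\<Sum>j\<in>{0..<N}. if j = i then f i * v $ i else 0)"
    by (rule sum.cong) auto
  finally show "(mat_diag N f *\<^sub>v v) $ i = vec N (\<lambda>r. f r * v $ r) $ i" using i by simp
qed simp

section \<open>The Hadamard gate on qubit 1\<close>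

lemma qubit_mod:
  assumes "d \<in> {1..n}" "d \<noteq> 1"
  shows "qubit n d (r mod 2 ^ (n - 1)) = qubit n d r"
proof -
  \<comment> \<open>Qubit \<open>d\<close> sits at bit \<open>n - d\<close>, below the bits from
    \<open>n - 1\<close> upwards that the reduction clears.\<close>
  have "n - d < n - 1" using assms by auto
  then show ?thesis by (simp add: qubit_eq_bit bit_take_bit_iff flip: take_bit_eq_mod)
qed

lemma qubit_1:
  assumes "r < 2 ^ n" "1 \<le> n"
  shows "qubit n 1 r = r div 2 ^ (n - 1)"
proof -
  have "r < 2 * 2 ^ (n - 1)" using assms by (metis One_nat_def Suc_le_eq power_Suc Suc_pred)
  then have "r div 2 ^ (n - 1) < 2" by (simp add: less_mult_imp_div_less)
  then show ?thesis by (simp add: qubit_def)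
qed

text \<open>Row \<open>r\<close> of the operator is nonzero only in the two columns that agree with
  \<open>r\<close> outside qubit 1: \<open>m\<close> is \<open>r\<close> with qubit 1 set to 0, and
  \<open>m + 2 ^ (n - 1)\<close> is \<open>r\<close> with qubit 1 set to 1.\<close>

lemma H_op_1_mult_vec:
  assumes v: "v \<in> carrier_vec (2 ^ n)" and r: "r < 2 ^ n" and n: "1 \<le> n"
  defines "m \<equiv> r mod 2 ^ (n - 1)"
  shows "(H_op n 1 *\<^sub>v v) $ r
    = complex_of_real (1 / sqrt 2) * (v $ m + (-1) ^ qubit n 1 r * v $ (m + 2 ^ (n - 1)))"
proof -
  let ?M = "2 ^ (n - 1) :: nat"
  have N: "2 ^ n = 2 * ?M" using n by (metis One_nat_def Suc_le_eq power_Suc Suc_pred)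
  have m: "m < ?M" by (simp add: m_def)
  \<comment> \<open>The qubits other than 1 determine the residue modulo \<open>?M\<close>, and each
    residue has exactly two representatives below \<open>2 * ?M\<close>.\<close>
  have agree: "(\<forall>d\<in>{1..n} - {1}. qubit n d r = qubit n d c) \<longleftrightarrow> c = m \<or> c = m + ?M"
    if c: "c < 2 ^ n" for c
  proof -
    have "(\<forall>d\<in>{1..n} - {1}. qubit n d r = qubit n d c) \<longleftrightarrow> c mod ?M = m"
    proof
      assume *: "\<forall>d\<in>{1..n} - {1}. qubit n d r = qubit n d c"
      have "c mod ?M = r mod ?M"
      proof (rule index_eq_if_qubits_eq[of _ n])
        fix d assume d: "d \<in> {1..n}"
        have lt: "x mod ?M < 2 ^ n" for x
          unfolding N by (rule less_le_trans[OF mod_less_divisor]) simp_all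
        show "qubit n d (c mod ?M) = qubit n d (r mod ?M)"
        \<comment> \<open>Both residues lie below \<open>?M\<close>, so their qubit 1 is 0; the
          other qubits survive the reduction.\<close>
        proof (cases "d = 1")
          case True
          then show ?thesis using qubit_1[OF lt n] by simp
        next
          case False
          then show ?thesis using d * by (metis qubit_mod DiffI singletonD)
        qed
      qed (use N in \<open>simp_all add: less_le_trans[OF mod_less_divisor]\<close>)
      then show "c mod ?M = m" by (simp add: m_def)
    next
      assume c: "c mod ?M = m"
      show "\<forall>d\<in>{1..n} - {1}. qubit n d r = qubit n d c"
      proof
        fix d assume "d \<in> {1..n} - {1}"
        then have "d \<in> {1..n}" "d \<noteq> 1" by blast+
        then show "qubit n d r = qubit n d c"
          using c by (metis qubit_mod m_def)
      qed
    qed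
    also have "\<dots> \<longleftrightarrow> c = m \<or> c = m + ?M"
    proof (cases "c < ?M")
      case True
      then show ?thesis by auto
    next
      case False
      then have "c mod ?M = c - ?M" using c N by (simp add: mod_if)
      then show ?thesis using False m by auto
    qed
    finally show ?thesis .
  qed
  have q: "qubit n 1 m = 0" "qubit n 1 (m + ?M) = 1"
    using m N qubit_1[OF _ n, of m] qubit_1[OF _ n, of "m + ?M"] by simp_all
  let ?W = "\<lambda>c. gate_H $$ (qubit n 1 r, qubit n 1 c)"
  have "(H_op n 1 *\<^sub>v v) $ r = (\<Sum>c\<in>{0..<2 ^ n}. (if c = m \<or> c = m + ?M then ?W c else 0) * v $ c)"
    using r v by (simp add: on_qubit_def scalar_prod_def agree[simplified] cong: if_cong)
  also have "\<dots> = (\<Sum>c\<in>{m, m + ?M}. ?W c * v $ c)"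
    using m N by (intro sum.mono_neutral_cong_right) auto
  also have "\<dots> = ?W m * v $ m + ?W (m + ?M) * v $ (m + ?M)" by simp
  \<comment> \<open>Up to the factor \<open>1 / sqrt 2\<close>, the entry of \<open>gate_H\<close>
    is -1 to the power row times column, so only column 1 carries a sign.\<close>
  also have "\<dots> = complex_of_real (1 / sqrt 2) * (v $ m + (-1) ^ qubit n 1 r * v $ (m + ?M))"
    unfolding q by (auto simp: gate_H_def mat_of_rows_list_def qubit_eq_bit algebra_simps)
  finally show ?thesis .
qed

section \<open>Amplitudes of the graph state\<close>

lemma finite_edges:
  assumes "simple_graph_on V E"
  shows "finite E"
  using assms unfolding simple_graph_on_def
  by (meson Pow_iff finite_Pow_iff finite_subset subsetI)

lemma graph_state_eq:
  assumes G: "simple_graph_on {1..n} E"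
  shows "graph_state n E = vec (2 ^ n)
    (\<lambda>r. (\<Prod>e\<in>E. (-1) ^ (\<Prod>a\<in>e. qubit n a r)) * complex_of_real (1 / sqrt 2) ^ n)"
proof -
  have finE: "finite E" using G by (rule finite_edges)
  have CZ: "CZ n (Min e) (Max e) = mat_diag (2 ^ n) (\<lambda>r. (-1) ^ (\<Prod>a\<in>e. qubit n a r))"
    if "e \<in> E" for e
  proof -
    from that G obtain a b where e: "e = {a, b}" "a \<noteq> b" "a \<in> {1..n}" "b \<in> {1..n}"
      by (auto simp: simple_graph_on_def card_2_iff)
    then show ?thesis
      \<comment> \<open>Either endpoint may be the smaller one, so the gate is needed with both
        choices of control.\<close>
      unfolding gate_Z_def using controlled_diagonal[of a n b "-1"] controlled_diagonal[of b n a "-1"]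
      by (cases "a < b") (auto simp: mult.commute min_def max_def)
  qed
  have "ket_plus $ qubit n a r = complex_of_real (1 / sqrt 2)" for a r
    by (auto simp: ket_plus_def qubit_eq_bit)
  then have "tensor_power n ket_plus = vec (2 ^ n) (\<lambda>r. complex_of_real (1 / sqrt 2) ^ n)"
    by (simp add: tensor_power_def)
  then show ?thesis
    unfolding graph_state_def by (auto simp: finprod_mat_diag[OF finE CZ] mat_diag_mult_vec)
qed

text \<open>Only the edges at vertex 1 involve qubit 1; they give the explicit sign. Letting
  \<open>\<phi>\<close> take the residue as argument makes it independent of qubit 1.\<close>

lemma graph_state_split_qubit_1:
  assumes G: "simple_graph_on {1..n} E" and n: "1 \<le> n"
  obtains \<phi> where "\<And>r. r < 2 ^ n \<Longrightarrow> graph_state n E $ r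
    = (-1) ^ (qubit n 1 r * (\<Sum>j\<in>nbhd E 1. qubit n j r)) * \<phi> (r mod 2 ^ (n - 1))"
proof -
  let ?N = "nbhd E 1" and ?E' = "{e \<in> E. 1 \<notin> e}"
  have finE: "finite E" using G by (rule finite_edges)
  have E: "E = (\<lambda>j. {1, j}) ` ?N \<union> ?E'"
  proof (intro equalityI subsetI)
    fix e assume e: "e \<in> E"
    with G obtain a b where "e = {a, b}" by (auto simp: simple_graph_on_def card_2_iff)
    then show "e \<in> (\<lambda>j. {1, j}) ` ?N \<union> ?E'"
      using e by (cases "a = 1"; cases "b = 1") (auto simp: nbhd_def insert_commute)
  qed (auto simp: nbhd_def)
  have N1: "1 \<notin> ?N" using G by (auto simp: nbhd_def simple_graph_on_def)
  have inj: "inj_on (\<lambda>j. {1, j}) ?N" by (auto simp: inj_on_def doubleton_eq_iff)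
  show thesis
  proof (rule that[of "\<lambda>m. (\<Prod>e\<in>?E'. (-1) ^ (\<Prod>a\<in>e. qubit n a m)) * complex_of_real (1 / sqrt 2) ^ n"])
    fix r :: nat assume r: "r < 2 ^ n"
    let ?w = "\<lambda>r e. (-1::complex) ^ (\<Prod>a\<in>e. qubit n a r)"
    have "prod (?w r) E = prod (?w r) ((\<lambda>j. {1, j}) ` ?N) * prod (?w r) ?E'"
      by (subst E, rule prod.union_disjoint) (use finE E in \<open>auto intro: finite_subset\<close>)
    also have "prod (?w r) ((\<lambda>j. {1, j}) ` ?N) = (\<Prod>j\<in>?N. (-1) ^ (qubit n 1 r * qubit n j r))"
      unfolding prod.reindex[OF inj] comp_def
    proof (intro prod.cong refl)
      fix j assume "j \<in> ?N"
      \<comment> \<open>Distinctness makes the product over \<open>{1, j}\<close> split into two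
        factors.\<close>
      then have "1 \<noteq> j" using N1 by metis
      then show "?w r {1, j} = (-1) ^ (qubit n 1 r * qubit n j r)" by simp
    qed
    also have "\<dots> = (-1) ^ (qubit n 1 r * (\<Sum>j\<in>?N. qubit n j r))"
      by (simp add: sum_distrib_left flip: power_sum)
    also have "prod (?w r) ?E' = prod (?w (r mod 2 ^ (n - 1))) ?E'"
    proof (intro prod.cong refl arg_cong[where f="\<lambda>m. (-1) ^ m"])
      fix e a assume e: "e \<in> ?E'" "a \<in> e"
      then have "a \<in> {1..n}" "a \<noteq> 1" using G unfolding simple_graph_on_def by blast+
      then show "qubit n a r = qubit n a (r mod 2 ^ (n - 1))" by (rule qubit_mod[symmetric])
    qed
    finally show "graph_state n E $ r = (-1) ^ (qubit n 1 r * (\<Sum>j\<in>?N. qubit n j r)) *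
      ((\<Prod>e\<in>?E'. (-1) ^ (\<Prod>a\<in>e. qubit n a (r mod 2 ^ (n - 1)))) * complex_of_real (1 / sqrt 2) ^ n)"
      by (simp add: graph_state_eq[OF G] r)
  qed
qed

section \<open>Arithmetic of signs and fourth roots of unity\<close>

text \<open>A square is congruent to 0 or 1 modulo 4, according to the parity of its root.\<close>

lemma power_square_fourth_root:
  fixes K :: "'a :: monoid_mult"
  assumes "K ^ 4 = 1"
  shows "K ^ (s * s) = (if even s then 1 else K)"
proof (cases "even s")
  case True
  then obtain u where "s = 2 * u" by blast
  then have "s * s = 4 * (u * u)" by simp
  then show ?thesis using True assms by (metis power_mult power_one)
next
  case False
  then obtain u where "s = 2 * u + 1" using oddE by blast
  then have "s * s = Suc (4 * (u * u + u))" by (simp add: algebra_simps)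
  then have "K ^ (s * s) = K * (K ^ 4) ^ (u * u + u)" by (metis power_Suc power_mult)
  then show ?thesis using False assms by simp
qed

text \<open>The summands on the right come from the values 0 and 1 of qubit 1 before the Hadamard gate;
  \<open>y\<close> is its value afterwards.\<close>

lemma hadamard_sum_identity:
  fixes K :: "'a :: comm_ring_1"
  assumes "K ^ 4 = 1"
  shows "(1 + K * (-1) ^ (y + b)) * (-1) ^ (y * s)
    = K ^ (s * s) * (-1) ^ (s * b)
      + (-1) ^ y * (- (K ^ ((1 + s) * (1 + s)) * (-1) ^ ((1 + s) * (1 + b)) * (-1) ^ s))"
  unfolding power_square_fourth_root[OF assms]
  by (cases "even s"; cases "even b"; cases "even y") (simp_all add: uminus_power_if)

section \<open>Entrywise comparison of the two sides\<close>

theorem propositionB: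
  fixes n :: nat and E :: "nat set set" and A B :: "nat set" and k :: int
  assumes "simple_graph_on {1..n} E"
    and "A = nbhd E 1 \<union> {1}"
    and "B \<subseteq> {1..n}"
    and "1 \<in> B"
  shows "(complex_of_real (1 / sqrt 2) \<cdot>\<^sub>m
            (1\<^sub>m (2 ^ n) + (\<i> powi k) \<cdot>\<^sub>m (\<Otimes>\<^bsub>op_ring n\<^esub>j\<in>B. Z_op n j))) *\<^sub>v graph_state n E
       = (H_op n 1 * Z_op n 1
            * finprod (op_ring n) (\<lambda>(x, y). CS n x y [^]\<^bsub>op_ring n\<^esub> k) (A \<times> A)
            * finprod (op_ring n) (\<lambda>(x, y). CZ n x y) (A \<times> B)) *\<^sub>v graph_state n E"
proof -
  let ?c = "complex_of_real (1 / sqrt 2)" and ?M = "2 ^ (n - 1) :: nat"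
  let ?N = "nbhd E 1" and ?\<psi> = "graph_state n E"
  define q where "q = qubit n"
  define K where "K = \<i> powi k"
  define S where "S r = (\<Sum>j\<in>A. q j r)" for r
  define T where "T r = (\<Sum>j\<in>B. q j r)" for r
  have G: "simple_graph_on {1..n} E" by fact
  have n: "1 \<le> n" using assms(3,4) by auto
  have N: "?N \<subseteq> {1..n}" "1 \<notin> ?N"
    using G by (auto simp: nbhd_def simple_graph_on_def)
  have finN: "finite ?N" and B: "finite B"
    using N(1) assms(3) finite_subset by blast+
  have A: "A \<subseteq> {1..n}" "finite A" using N n finN assms(2) by auto
  \<comment> \<open>Both \<open>(\<i> ^ 4) powi k\<close> and \<open>K ^ 4\<close> equal
    \<open>\<i> powi (4 * k)\<close>, and \<open>\<i> ^ 4 = 1\<close>.\<close>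
  have K4: "K ^ 4 = 1"
    using power_int_power[of \<i> 4 k] by (simp add: K_def power_int_power' mult.commute)
  have \<psi>: "?\<psi> \<in> carrier_vec (2 ^ n)" by (simp add: graph_state_eq[OF G])
  have Z: "(\<Otimes>\<^bsub>op_ring n\<^esub>j\<in>B. Z_op n j) = mat_diag (2 ^ n) (\<lambda>r. (-1) ^ T r)"
    unfolding T_def q_def power_sum
    by (rule finprod_mat_diag[OF B]) (use assms(3) in \<open>auto simp: gate_Z_def on_qubit_diagonal\<close>)
  have CS: "finprod (op_ring n) (\<lambda>(x, y). CS n x y [^]\<^bsub>op_ring n\<^esub> k) (A \<times> A)
      = mat_diag (2 ^ n) (\<lambda>r. K ^ (S r * S r))"
  proof -
    have "(case p of (x, y) \<Rightarrow> CS n x y [^]\<^bsub>op_ring n\<^esub> k)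
        = mat_diag (2 ^ n) (\<lambda>r. K ^ (q (fst p) r * q (snd p) r))" if "p \<in> A \<times> A" for p
      using that A
      by (auto simp: gate_S_def controlled_diagonal int_pow_mat_diag subset_iff q_def K_def
          power_int_power power_int_power' mult.commute)
    then have "finprod (op_ring n) (\<lambda>(x, y). CS n x y [^]\<^bsub>op_ring n\<^esub> k) (A \<times> A)
        = mat_diag (2 ^ n) (\<lambda>r. \<Prod>p\<in>A \<times> A. K ^ (q (fst p) r * q (snd p) r))"
      using A by (intro finprod_mat_diag) auto
    \<comment> \<open>The exponents add up over all ordered pairs, and the double sum of products of
      bits factors as \<open>S r * S r\<close>.\<close>
    then show ?thesis
      by (simp add: S_def sum_product sum.cartesian_product case_prod_unfold flip: power_sum)
  qed
  have CZ: "finprod (op_ring n) (\<lambda>(x, y). CZ n x y) (A \<times> B)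
      = mat_diag (2 ^ n) (\<lambda>r. (-1) ^ (S r * T r))"
  proof -
    have "(case p of (x, y) \<Rightarrow> CZ n x y)
        = mat_diag (2 ^ n) (\<lambda>r. (-1) ^ (q (fst p) r * q (snd p) r))" if "p \<in> A \<times> B" for p
      using that A assms(3) by (auto simp: gate_Z_def controlled_diagonal subset_iff q_def)
    then have "finprod (op_ring n) (\<lambda>(x, y). CZ n x y) (A \<times> B)
        = mat_diag (2 ^ n) (\<lambda>r. \<Prod>p\<in>A \<times> B. (-1) ^ (q (fst p) r * q (snd p) r))"
      using A B by (intro finprod_mat_diag) auto
    then show ?thesis
      by (simp add: S_def T_def sum_product sum.cartesian_product case_prod_unfold flip: power_sum)
  qed
  have Z1: "Z_op n 1 = mat_diag (2 ^ n) (\<lambda>r. (-1) ^ q 1 r)"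
    unfolding gate_Z_def q_def using n by (intro on_qubit_diagonal) simp
  \<comment> \<open>This is the state just before the Hadamard gate acts.\<close>
  define v where
    "v = vec (2 ^ n) (\<lambda>r. (-1) ^ q 1 r * K ^ (S r * S r) * (-1) ^ (S r * T r) * ?\<psi> $ r)"
  have H: "H_op n 1 \<in> carrier_mat (2 ^ n) (2 ^ n)" by (simp add: on_qubit_def)
  have lhs: "?c \<cdot>\<^sub>m (1\<^sub>m (2 ^ n) + K \<cdot>\<^sub>m (\<Otimes>\<^bsub>op_ring n\<^esub>j\<in>B. Z_op n j))
      = mat_diag (2 ^ n) (\<lambda>r. ?c * (1 + K * (-1) ^ T r))"
    unfolding Z by (auto simp: mat_diag_def)
  have rhs: "(H_op n 1 * Z_op n 1
            * finprod (op_ring n) (\<lambda>(x, y). CS n x y [^]\<^bsub>op_ring n\<^esub> k) (A \<times> A)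
            * finprod (op_ring n) (\<lambda>(x, y). CZ n x y) (A \<times> B)) *\<^sub>v ?\<psi> = H_op n 1 *\<^sub>v v"
    unfolding CS CZ Z1 v_def using H \<psi>
    by (simp add: assoc_mult_mat[of _ "2 ^ n" "2 ^ n" _ "2 ^ n" _ "2 ^ n"]
        assoc_mult_mat_vec[of _ "2 ^ n" "2 ^ n" _ "2 ^ n"] mat_diag_mult_vec mult.assoc)
  obtain \<phi> where \<phi>: "\<And>r. r < 2 ^ n \<Longrightarrow>
      ?\<psi> $ r = (-1) ^ (q 1 r * (\<Sum>j\<in>?N. q j r)) * \<phi> (r mod ?M)"
    using graph_state_split_qubit_1[OF G n] unfolding q_def by blast
  have "(?c * (1 + K * (-1) ^ T r)) * ?\<psi> $ r = (H_op n 1 *\<^sub>v v) $ r" if r: "r < 2 ^ n" for r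
  proof -
    \<comment> \<open>Here \<open>m\<close> is \<open>r\<close> with qubit 1 cleared, while
      \<open>s\<close> and \<open>b\<close> are the parts of \<open>S\<close> and \<open>T\<close>
      that do not involve qubit 1; they are shared by \<open>r\<close>, \<open>m\<close> and
      \<open>m + ?M\<close>.\<close>
    define m where "m = r mod ?M"
    define s where "s = (\<Sum>j\<in>?N. q j m)"
    define b where "b = (\<Sum>j\<in>B - {1}. q j m)"
    have M: "2 ^ n = 2 * ?M" using n by (metis One_nat_def Suc_le_eq power_Suc Suc_pred)
    have m: "m < ?M" by (simp add: m_def)
    have lt: "m < 2 ^ n" "m + ?M < 2 ^ n" using m M by linarith+
    have same: "q j x = q j m" if "x mod ?M = m" "j \<in> {1..n}" "j \<noteq> 1" for x j
      using qubit_mod[of j n x] that by (simp add: q_def)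
    have sums: "(\<Sum>j\<in>?N. q j x) = s" "S x = q 1 x + s" "T x = q 1 x + b"
      if x: "x mod ?M = m" for x
    proof -
      show s: "(\<Sum>j\<in>?N. q j x) = s"
        unfolding s_def by (rule sum.cong) (use N same[OF x] in blast)+
      show "S x = q 1 x + s"
        unfolding S_def assms(2) using N finN s by simp
      have "(\<Sum>j\<in>B - {1}. q j x) = b"
        unfolding b_def by (rule sum.cong) (use assms(3) same[OF x] in blast)+
      then show "T x = q 1 x + b"
        unfolding T_def using B assms(4) by (simp add: sum.remove)
    qed
    have mods: "r mod ?M = m" "m mod ?M = m" "(m + ?M) mod ?M = m"
      using m by (simp_all add: m_def)
    have q1: "q 1 m = 0" "q 1 (m + ?M) = 1"
      using m qubit_1[OF lt(1) n] qubit_1[OF lt(2) n] by (simp_all add: q_def)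
    have v0: "v $ m = K ^ (s * s) * (-1) ^ (s * b) * \<phi> m"
      using lt m by (simp add: v_def \<phi> sums[OF mods(2)] q1[simplified] mods)
    \<comment> \<open>With qubit 1 equal to 1, the leading minus sign comes from the gate Z on qubit
      1 and the last factor \<open>(-1) ^ s\<close> from the edges at vertex 1.\<close>
    have v1: "v $ (m + ?M)
        = - (K ^ ((1 + s) * (1 + s)) * (-1) ^ ((1 + s) * (1 + b)) * (-1) ^ s) * \<phi> m"
      using lt m by (simp add: v_def \<phi> sums[OF mods(3), unfolded q1, simplified] q1[simplified])
    have "(?c * (1 + K * (-1) ^ T r)) * ?\<psi> $ r
        = ?c * ((1 + K * (-1) ^ (q 1 r + b)) * (-1) ^ (q 1 r * s)) * \<phi> m"
      unfolding \<phi>[OF r] sums[OF mods(1)] mods(1) by (simp only: mult.assoc)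
    \<comment> \<open>The scalar identity is applied with \<open>y\<close> equal to
      \<open>q 1 r\<close>, the value of qubit 1 after the Hadamard gate.\<close>
    also have "\<dots> = ?c * (v $ m + (-1) ^ q 1 r * v $ (m + ?M))"
      unfolding hadamard_sum_identity[OF K4] v0 v1 by (simp only: algebra_simps)
    also have "\<dots> = (H_op n 1 *\<^sub>v v) $ r"
      unfolding m_def q_def by (rule H_op_1_mult_vec[symmetric]) (use r n in \<open>auto simp: v_def\<close>)
    finally show ?thesis .
  qed
  then have "mat_diag (2 ^ n) (\<lambda>r. ?c * (1 + K * (-1) ^ T r)) *\<^sub>v ?\<psi> = H_op n 1 *\<^sub>v v"
    using H \<psi> by (intro eq_vecI) (auto simp: mat_diag_mult_vec)
  then show ?thesis
    unfolding rhs K_def[symmetric] lhs .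
qed

end
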